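(* For every integer $n\ge 3$, the set of $\alpha\in(0,1)$ such that there exist $i=i_\alpha$, $j=j_\alpha$ with $T_{3,n,\alpha}^{\,i}(r_0(\alpha))=T_{3,n,\alpha}^{\,j}(\ell_0(\alpha))$ has full Lebesgue measure in $(0,1)$.
   Context: Let $n\ge 3$ and $t=1+2\cos(\pi/n)$. Put $A=\begin{pmatrix}1&t\\0&1\end{pmatrix}$, $C=\begin{pmatrix}-1&1\\-1&0\end{pmatrix}$, acting on $\mathbb R\cup\{\infty\}$ by Möbius transformations; thus $A^k\cdot x=x+kt$ and $C\cdot x=1-1/x$. For $\alpha\in[0,1]$ let $\mathbb I_\alpha=[(\alpha-1)t,\alpha t)$. The map $T_\alpha=T_{3,n,\alpha}$ is defined on the closed interval $[(\alpha-1)t,\alpha t]$, with values in $\mathbb I_\alpha$, by $T_\alpha(x)=A^kC^l\cdot x$, where $l\ge1$ is the minimal integer with $C^l\cdot x\notin\mathbb I_\alpha$ and $k=-\lfloor (C^l\cdot x)/t+1-\alpha\rfloor$. (If $C^l\cdot x=\infty$, set $T_\alpha(x)=\infty$ and the orbit stops there.) Set $\ell_0(\alpha)=(\alpha-1)t$ and $r_0(\alpha)=\alpha t$. Here $i,j$ are non-negative integers. *)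

theory Defs
  imports "HOL-Analysis.Analysis"
begin

text \<open>
  The projective line \<open>\<real> \<union> {\<infinity>}\<close> is \<^typ>\<open>real option\<close>, with \<^term>\<open>None\<close> as \<open>\<infinity>\<close>.
  If the denominator vanishes, the value is \<open>\<infinity>\<close>; for invertible \<open>M\<close> this is the usual
  action by Moebius transformations.
\<close>

definition moebius :: "real^2^2 \<Rightarrow> real option \<Rightarrow> real option" where
  "moebius M p = (case p of
      None \<Rightarrow> if M$2$1 = 0 then None else Some (M$1$1 / M$2$1)
    | Some x \<Rightarrow> if M$2$1 * x + M$2$2 = 0 then None
                else Some ((M$1$1 * x + M$1$2) / (M$2$1 * x + M$2$2)))"

text \<open>Integer powers for the matrix product: the library's \<open>^\<close> on vectors is componentwise.\<close>

definition mat_pow :: "real^2^2 \<Rightarrow> nat \<Rightarrow> real^2^2" where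
  "mat_pow M m = (((**) M) ^^ m) (mat 1)"

definition mat_powi :: "real^2^2 \<Rightarrow> int \<Rightarrow> real^2^2" where
  "mat_powi M k = (if k \<ge> 0 then mat_pow M (nat k) else mat_pow (matrix_inv M) (nat (- k)))"

definition tval :: "nat \<Rightarrow> real" where
  "tval n = 1 + 2 * cos (pi / real n)"

definition matA :: "nat \<Rightarrow> real^2^2" where
  "matA n = vector [vector [1, tval n], vector [0, 1]]"

definition matC :: "real^2^2" where
  "matC = vector [vector [-1, 1], vector [-1, 0]]"

definition ell0 :: "nat \<Rightarrow> real \<Rightarrow> real" where
  "ell0 n \<alpha> = (\<alpha> - 1) * tval n"

definition r0 :: "nat \<Rightarrow> real \<Rightarrow> real" where
  "r0 n \<alpha> = \<alpha> * tval n"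

definition I_interval :: "nat \<Rightarrow> real \<Rightarrow> real set" where
  "I_interval n \<alpha> = {ell0 n \<alpha>..<r0 n \<alpha>}"

text \<open>
  Such an exponent always exists (\<open>l_exp_exists\<close> below), so \<open>LEAST\<close> is meaningful.
\<close>

definition l_exp :: "nat \<Rightarrow> real \<Rightarrow> real \<Rightarrow> nat" where
  "l_exp n \<alpha> x =
     (LEAST l. 1 \<le> l \<and> moebius (mat_pow matC l) (Some x) \<notin> Some ` I_interval n \<alpha>)"

definition k_exp :: "nat \<Rightarrow> real \<Rightarrow> real \<Rightarrow> int" where
  "k_exp n \<alpha> y = - \<lfloor>y / tval n + 1 - \<alpha>\<rfloor>"

text \<open>
  Only the values on the closed interval from \<^term>\<open>ell0 n \<alpha>\<close> to \<^term>\<open>r0 n \<alpha>\<close> are of interest.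
  That an orbit stops at \<open>\<infinity>\<close> is encoded by making \<open>\<infinity>\<close> a fixed point; this adds no new
  values to an orbit.
\<close>

definition T_map :: "nat \<Rightarrow> real \<Rightarrow> real option \<Rightarrow> real option" where
  "T_map n \<alpha> p = (case p of
      None \<Rightarrow> None
    | Some x \<Rightarrow>
        (let Cl = mat_pow matC (l_exp n \<alpha> x) in
         case moebius Cl (Some x) of
           None \<Rightarrow> None
         | Some y \<Rightarrow> moebius (mat_powi (matA n) (k_exp n \<alpha> y) ** Cl) (Some x)))"

lemma mat2_mult:
  fixes M N :: "real^2^2"
  shows "(M ** N)$i$j = M$i$1 * N$1$j + M$i$2 * N$2$j"
  by (simp add: matrix_matrix_mult_def sum_2)

lemma mat2_eq_iff:
  fixes M N :: "real^2^2"
  shows "M = N \<longleftrightarrow> M$1$1 = N$1$1 \<and> M$1$2 = N$1$2 \<and> M$2$1 = N$2$1 \<and> M$2$2 = N$2$2"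
  by (auto simp: vec_eq_iff forall_2)

lemma moebius_matC: "moebius matC (Some x) = (if x = 0 then None else Some (1 - 1 / x))"
  by (auto simp: moebius_def matC_def field_simps)

lemma mat_pow_shear:
  fixes s :: real
  shows "mat_pow (vector [vector [1, s], vector [0, 1]]) m
         = vector [vector [1, real m * s], vector [0, 1]]"
proof (induction m)
  case 0
  show ?case by (simp add: mat_pow_def mat2_eq_iff mat_def)
next
  case (Suc m)
  then show ?case by (simp add: mat_pow_def mat2_eq_iff mat2_mult algebra_simps)
qed

lemma matrix_inv_matA: "matrix_inv (matA n) = vector [vector [1, - tval n], vector [0, 1]]"
proof -
  let ?B = "vector [vector [1, - tval n], vector [0, 1]] :: real^2^2"
  have AB: "matA n ** ?B = mat 1" "?B ** matA n = mat 1"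
    by (simp_all add: mat2_eq_iff mat2_mult matA_def mat_def)
  then have "matA n ** matrix_inv (matA n) = mat 1"
    unfolding matrix_inv_def by (rule someI2[where a = ?B, OF conjI]) simp
  then have "?B ** (matA n ** matrix_inv (matA n)) = ?B" by simp
  then show ?thesis by (simp add: matrix_mul_assoc AB)
qed

lemma mat_powi_matA:
  "mat_powi (matA n) k = vector [vector [1, of_int k * tval n], vector [0, 1]]"
  by (simp add: mat_powi_def matrix_inv_matA mat_pow_shear) (simp add: matA_def mat_pow_shear)

lemma moebius_mat_powi_matA: "moebius (mat_powi (matA n) k) (Some x) = Some (x + of_int k * tval n)"
  by (simp add: mat_powi_matA moebius_def)

lemma mat_pow_matC_3: "mat_pow matC 3 = mat 1"
  by (simp add: mat_pow_def eval_nat_numeral mat2_eq_iff mat2_mult matC_def mat_def)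

lemma l_exp_exists:
  "\<exists>l\<ge>1. moebius (mat_pow matC l) (Some x) \<notin> Some ` I_interval n \<alpha>"
proof (rule ccontr)
  assume "\<not> ?thesis"
  then have H: "moebius (mat_pow matC l) (Some x) \<in> Some ` I_interval n \<alpha>" if "l \<ge> 1" for l
    using that by blast
  have C1: "moebius (mat_pow matC 1) (Some x) = (if x = 0 then None else Some (1 - 1 / x))"
    by (simp add: mat_pow_def moebius_matC)
  have C2: "moebius (mat_pow matC 2) (Some x) = (if x = 1 then None else Some (1 / (1 - x)))"
    by (auto simp: mat_pow_def eval_nat_numeral mat2_mult matC_def mat_def moebius_def field_simps)
  have C3: "moebius (mat_pow matC 3) (Some x) = Some x"
    unfolding mat_pow_matC_3 by (simp add: moebius_def mat_def)
  have x: "x \<noteq> 0" "x \<noteq> 1" "1 - 1 / x \<in> I_interval n \<alpha>" "1 / (1 - x) \<in> I_interval n \<alpha>"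
    "x \<in> I_interval n \<alpha>"
    using H[of 1] H[of 2] H[of 3] C1 C2 C3 by (auto split: if_splits)
  have t3: "tval n \<le> 3"
    using cos_le_one[of "pi / real n"] by (simp add: tval_def)
  have gap: "b - a < 3" if "a \<in> I_interval n \<alpha>" "b \<in> I_interval n \<alpha>" for a b
    using that t3 by (auto simp: I_interval_def ell0_def r0_def algebra_simps)
  have sq: "1 - 1 / y - y \<ge> 3" if "y < 0" for y :: real
  proof -
    have "1 - 1 / y - y - 3 = (y + 1)\<^sup>2 / (- y)"
      using that by (simp add: field_simps power2_eq_square)
    also have "\<dots> \<ge> 0" using that by (intro divide_nonneg_pos) auto
    finally show ?thesis by simp
  qed
  consider "x < 0" | "1 - 1 / x < 0" | "1 / (1 - x) < 0"
    using x(1,2) by (cases "x < 0"; cases "x < 1") (auto simp: field_simps)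
  then show False
  proof cases
    case 1
    then show ?thesis using sq[of x] gap[OF x(5) x(3)] by simp
  next
    case 2
    moreover have "1 - 1 / (1 - 1 / x) = 1 / (1 - x)" using x(1,2) by (simp add: field_simps)
    ultimately show ?thesis using sq[of "1 - 1 / x"] gap[OF x(3) x(4)] by simp
  next
    case 3
    moreover have "1 - 1 / (1 / (1 - x)) = x" using x(2) by simp
    ultimately show ?thesis using sq[of "1 / (1 - x)"] gap[OF x(4) x(5)] by simp
  qed
qed

end

theory Submission
  imports Defs
begin

text \<open>
  Let \<open>C x = 1 - 1 / x\<close>, and let \<open>R\<close> be the set of points that are congruent modulo \<open>t\<close> to a
  point of the orbit of \<open>ell0\<close>. On negative points the map acts as the elliptic element \<open>B\<close>
  (with \<open>A B = C\<close>) of order \<open>n\<close>, so the orbit of \<open>ell0\<close> follows \<open>B\<close>-orbits up to their positive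
  points. Suppose that the two orbits never meet, and that \<open>r0\<close> is not in the group orbit of
  \<open>\<infinity>\<close>. Then every point \<open>y\<close> of the orbit of \<open>r0\<close> is positive and the positive point on the
  \<open>B\<close>-orbit of \<open>y - t\<close> lies in \<open>R\<close>: any deviation from this lets the two orbits meet within a
  few steps. Hence the orbit of \<open>r0\<close> is its orbit under one map that does not depend on \<open>\<alpha>\<close>,
  and it stays in \<open>(0, r0]\<close>.

  The points whose orbit under that map stays in \<open>(0, \<rho>]\<close> with \<open>\<rho> < t\<close> form a null set: the
  Moebius-invariant measure \<open>dx dp / (x - p)\<^sup>2\<close> of a set of pairs above them is finite, the map acts
  injectively on these pairs and misses all pairs with \<open>p \<in> (t + 1, 2 t)\<close>.
\<close>

section \<open>The map and its rotation part\<close>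

lemma tval_bounds:
  assumes "n \<ge> 3"
  shows "2 \<le> tval n" "tval n < 3"
proof -
  have "pi / real n \<le> pi / 3" using assms by (simp add: field_simps)
  moreover have "0 < pi / real n" using assms by simp
  ultimately have "cos (pi/3) \<le> cos (pi / real n)"
    using pi_gt_zero by (intro cos_monotone_0_pi_le) linarith+
  then show "2 \<le> tval n" by (simp add: tval_def cos_60)
  have "cos (pi / real n) < cos 0"
    using \<open>0 < pi / real n\<close> \<open>pi / real n \<le> pi / 3\<close> pi_gt_zero
    by (intro cos_monotone_0_pi) linarith+
  then show "tval n < 3" by (simp add: tval_def)
qed

lemma moebius_mat_pow_C:
  "moebius (mat_pow matC 1) (Some x) = (if x = 0 then None else Some (1 - 1 / x))"
  "moebius (mat_pow matC 2) (Some x) = (if x = 1 then None else Some (1 / (1 - x)))"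
  by (simp add: mat_pow_def moebius_matC)
     (auto simp: mat_pow_def eval_nat_numeral mat2_mult matC_def mat_def moebius_def field_simps)

lemma k_exp_in_I:
  assumes "tval n > 0"
  shows "y + of_int (k_exp n \<alpha> y) * tval n \<in> I_interval n \<alpha>"
proof -
  let ?t = "tval n" and ?f = "\<lfloor>y / tval n + 1 - \<alpha>\<rfloor>"
  have "of_int ?f \<le> y / ?t + 1 - \<alpha>" "y / ?t + 1 - \<alpha> < of_int ?f + 1" by linarith+
  then have "of_int ?f * ?t \<le> (y / ?t + 1 - \<alpha>) * ?t" "(y / ?t + 1 - \<alpha>) * ?t < (of_int ?f + 1) * ?t"
    using assms by (auto intro: mult_right_mono mult_strict_right_mono)
  then show ?thesis
    using assms by (auto simp: k_exp_def I_interval_def ell0_def r0_def algebra_simps)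
qed

text \<open>Only the existence of \<open>k\<close> is recorded: a half-open interval of length
  \<open>t\<close> contains exactly one translate.\<close>

lemma T_map_C:
  assumes "tval n > 0" "x \<noteq> 0" "1 - 1 / x \<notin> I_interval n \<alpha>"
  shows "\<exists>k::int. T_map n \<alpha> (Some x) = Some (1 - 1 / x + of_int k * tval n)
      \<and> 1 - 1 / x + of_int k * tval n \<in> I_interval n \<alpha>"
proof -
  have l: "l_exp n \<alpha> x = 1"
    unfolding l_exp_def by (rule Least_equality) (use assms moebius_mat_pow_C(1)[of x] in auto)
  have "moebius (mat_powi (matA n) k ** mat_pow matC 1) (Some x) = Some (1 - 1 / x + of_int k * tval n)" for k
    using assms by (simp add: mat_powi_matA mat_pow_def moebius_def mat2_mult matC_def field_simps)
  then show ?thesis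
    using assms k_exp_in_I[OF assms(1), of "1 - 1 / x" \<alpha>] moebius_mat_pow_C(1)[of x]
    by (auto simp: T_map_def l Let_def simp del: One_nat_def)
qed

lemma T_map_CC:
  assumes "tval n > 0" "x \<noteq> 0" "x \<noteq> 1" "1 - 1 / x \<in> I_interval n \<alpha>" "1 / (1 - x) \<notin> I_interval n \<alpha>"
  shows "\<exists>k::int. T_map n \<alpha> (Some x) = Some (1 / (1 - x) + of_int k * tval n)
      \<and> 1 / (1 - x) + of_int k * tval n \<in> I_interval n \<alpha>"
proof -
  have l: "l_exp n \<alpha> x = 2"
    unfolding l_exp_def
  proof (rule Least_equality)
    show "1 \<le> (2::nat) \<and> moebius (mat_pow matC 2) (Some x) \<notin> Some ` I_interval n \<alpha>"
      using assms by (auto simp: moebius_mat_pow_C)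
    fix y assume y: "1 \<le> y \<and> moebius (mat_pow matC y) (Some x) \<notin> Some ` I_interval n \<alpha>"
    then have "y \<noteq> 1" using assms moebius_mat_pow_C(1)[of x] by auto
    with y show "2 \<le> y" by linarith
  qed
  have "moebius (mat_powi (matA n) k ** mat_pow matC 2) (Some x) = Some (1 / (1 - x) + of_int k * tval n)" for k
    using assms
    by (simp add: mat_powi_matA mat_pow_def moebius_def mat2_mult matC_def eval_nat_numeral mat_def field_simps)
  then show ?thesis
    using assms k_exp_in_I[OF assms(1), of "1 / (1 - x)" \<alpha>]
    by (auto simp: T_map_def l moebius_mat_pow_C Let_def)
qed

section \<open>The elliptic element \<open>B\<close> of order \<open>n\<close>\<close>

definition rot :: "nat \<Rightarrow> real \<Rightarrow> real" where
  "rot n x = 1 - 1 / x - tval n"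

text \<open>
  In the coordinate \<open>\<theta> \<mapsto> rot_angle n \<theta>\<close>, which increases from \<open>-\<infinity>\<close> to \<open>\<infinity>\<close> on \<open>(0, \<pi>)\<close>, the map
  \<open>rot n\<close> is \<open>\<theta> \<mapsto> \<theta> + \<pi> / n\<close>, and the negative points are those with \<open>\<theta> < \<pi> - \<pi> / n\<close>.
\<close>

definition rot_angle :: "nat \<Rightarrow> real \<Rightarrow> real" where
  "rot_angle n \<theta> = - sin (\<theta> + pi / n) / sin \<theta>"

text \<open>With p = pi / n this is sin \<theta> + sin (\<theta> + 2 p) = 2 cos p sin (\<theta> +
  p), divided by sin (\<theta> + p); note that 2 cos p = t - 1.\<close>

lemma rot_rot_angle:
  assumes "sin \<theta> \<noteq> 0" "sin (\<theta> + pi / n) \<noteq> 0"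
  shows "rot n (rot_angle n \<theta>) = rot_angle n (\<theta> + pi / n)"
proof -
  define p where "p = pi / n"
  have "sin \<theta> = 2 * cos p * sin (\<theta> + p) - sin (\<theta> + p + p)"
  proof -
    have "sin \<theta> = sin ((\<theta> + p) - p)" by simp
    then show ?thesis by (simp only: sin_diff sin_add[of "\<theta> + p" p]) (simp add: algebra_simps)
  qed
  then have "sin \<theta> / sin (\<theta> + p) = 2 * cos p - sin (\<theta> + p + p) / sin (\<theta> + p)"
    using assms by (simp add: p_def[symmetric] diff_divide_distrib)
  then show ?thesis
    by (simp add: rot_def rot_angle_def tval_def p_def[symmetric])
qed

lemma rot_angle_exists:
  assumes "n \<ge> 2"
  obtains \<theta> where "0 < \<theta>" "\<theta> < pi" "x = rot_angle n \<theta>"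
proof -
  define p where "p = pi / n"
  have sp: "sin p > 0" using assms by (auto simp: p_def field_simps intro!: sin_gt_zero)
  \<comment> \<open>For \<theta> = pi/2 + b the equation to solve reads x = - cos p + sin p tan
    b.\<close>
  define b where "b = arctan ((x + cos p) / sin p)"
  have b: "- (pi/2) < b" "b < pi/2" "tan b = (x + cos p) / sin p"
    by (simp_all only: b_def arctan_lbound arctan_ubound tan_arctan)
  have cb: "cos b > 0" using b by (intro cos_gt_zero_pi) auto
  have "sin (pi/2 + b) = cos b" "cos (pi/2 + b) = - sin b" by (auto simp: sin_add cos_add)
  moreover have "sin b * sin p = (x + cos p) * cos b"
    using b(3) cb sp by (simp add: tan_def field_simps)
  ultimately have "x = rot_angle n (pi/2 + b)"
    unfolding rot_angle_def p_def[symmetric] sin_add[of "pi/2 + b" p]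
    using cb by (simp add: field_simps)
  then show thesis using b by (intro that[of "pi/2 + b"]) auto
qed

lemma rot_angle_sign:
  assumes "n \<ge> 2" "0 < \<theta>" "\<theta> < pi"
  shows "rot_angle n \<theta> < 0 \<longleftrightarrow> \<theta> + pi / n < pi" "rot_angle n \<theta> > 0 \<longleftrightarrow> \<theta> + pi / n > pi"
proof -
  have p: "0 < pi / n" "pi / n < pi" using assms by (auto simp: field_simps)
  have s: "sin \<theta> > 0" using assms by (intro sin_gt_zero)
  have 1: "sin (\<theta> + pi / n) > 0" if "\<theta> + pi / n < pi" using that p assms by (intro sin_gt_zero) linarith+
  have 2: "sin (\<theta> + pi / n) < 0" if "\<theta> + pi / n > pi" using that p assms by (intro sin_lt_zero) linarith+
  have 3: "sin (\<theta> + pi / n) = 0" if "\<theta> + pi / n = pi" using that by simp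
  have *: "rot_angle n \<theta> < 0 \<longleftrightarrow> sin (\<theta> + pi / n) > 0" "rot_angle n \<theta> > 0 \<longleftrightarrow> sin (\<theta> + pi / n) < 0"
    using s by (auto simp: rot_angle_def field_simps)
  show "rot_angle n \<theta> < 0 \<longleftrightarrow> \<theta> + pi / n < pi" "rot_angle n \<theta> > 0 \<longleftrightarrow> \<theta> + pi / n > pi"
    unfolding * using 1 2 3 by (smt (verit))+
qed

lemma rot_cycle:
  assumes n: "n \<ge> 2" and x: "x > 0"
  shows "(rot n ^^ n) x = x" "\<And>i. 0 < i \<Longrightarrow> i < n \<Longrightarrow> (rot n ^^ i) x < 0"
proof -
  define p where "p = pi / n"
  have p: "p > 0" "n * p = pi" using n by (auto simp: p_def)
  obtain \<theta>' where \<theta>': "0 < \<theta>'" "\<theta>' < pi" "x = rot_angle n \<theta>'" using rot_angle_exists n by metis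
  \<comment> \<open>\<open>rot_angle\<close> has period pi, so this is another angle of
    \<open>x\<close>. It lies in (-p, 0), and the next \<open>n\<close> angles lie in (0, pi), only
    the last of them at a positive point.\<close>
  define \<theta> where "\<theta> = \<theta>' - pi"
  have \<theta>: "- p < \<theta>" "\<theta> < 0"
    using rot_angle_sign(2)[OF n \<theta>'(1,2)] \<theta>' x by (auto simp: p_def \<theta>_def)
  have x\<theta>: "x = rot_angle n \<theta>"
  proof -
    have "sin \<theta> = - sin \<theta>'" "sin (\<theta> + p) = - sin (\<theta>' + p)"
      using sin_minus_pi[of "\<theta>'"] sin_minus_pi[of "\<theta>' + p"] by (auto simp: \<theta>_def algebra_simps)
    then show ?thesis by (simp add: \<theta>'(3) rot_angle_def p_def)
  qed
  have pos: "0 < \<theta> + i * p \<and> \<theta> + i * p < pi" if "1 \<le> i" "i \<le> n" for i :: nat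
  proof -
    have "1 * p \<le> i * p" "i * p \<le> n * p" using that p(1) by (intro mult_right_mono; simp)+
    then show ?thesis using \<theta> p by linarith
  qed
  have it: "(rot n ^^ i) x = rot_angle n (\<theta> + i * p)" if "i \<le> n" for i
    using that
  proof (induction i)
    case (Suc i)
    have "sin (\<theta> + i * p) \<noteq> 0"
    proof (cases i)
      case 0
      have "sin \<theta> < 0" using sin_lt_zero[of "\<theta> + 2*pi"] \<theta> \<theta>' by (auto simp: \<theta>_def)
      then show ?thesis using 0 by simp
    next
      case (Suc j)
      then show ?thesis using pos[of i] sin_gt_zero[of "\<theta> + i * p"] Suc.prems by auto
    qed
    moreover have "sin (\<theta> + i * p + p) \<noteq> 0"
      using pos[of "Suc i"] sin_gt_zero[of "\<theta> + Suc i * p"] Suc.prems by (auto simp: algebra_simps)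
    moreover have "\<theta> + Suc i * p = \<theta> + i * p + p" by (simp add: algebra_simps)
    ultimately show ?case
      using Suc rot_rot_angle[of "\<theta> + i * p" n] unfolding p_def[symmetric] by (simp add: add.assoc)
  qed (simp add: x\<theta>)
  have "sin (\<theta> + pi) = - sin \<theta>" "sin (\<theta> + pi + p) = - sin (\<theta> + p)"
    using sin_periodic_pi[of \<theta>] sin_periodic_pi[of "\<theta> + p"] by (auto simp: algebra_simps)
  then show "(rot n ^^ n) x = x" using it[of n] p by (simp add: x\<theta> rot_angle_def p_def)
  fix i assume i: "0 < i" "i < n"
  then show "(rot n ^^ i) x < 0"
    using it[of i] pos[of i] pos[of "Suc i"] rot_angle_sign(1)[OF n, of "\<theta> + i * p"]
    unfolding p_def[symmetric] by (simp add: algebra_simps)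
qed

text \<open>While the iterates are negative, the angle stays below pi but grows by pi / n each
  time.\<close>

lemma rot_escape:
  assumes n: "n \<ge> 2"
  shows "\<exists>i. (rot n ^^ i) x \<ge> 0"
proof (rule ccontr)
  assume H: "\<not> ?thesis"
  define p where "p = pi / n"
  have p: "p > 0" "p < pi" using n by (auto simp: p_def field_simps)
  obtain \<theta> where \<theta>: "0 < \<theta>" "\<theta> < pi" "x = rot_angle n \<theta>" using rot_angle_exists n by metis
  have it: "(rot n ^^ i) x = rot_angle n (\<theta> + i * p) \<and> \<theta> + i * p < pi" for i
  proof (induction i)
    case (Suc i)
    have ge: "0 < \<theta> + i * p" using \<theta> p by (simp add: add_pos_nonneg)
    have "(rot n ^^ i) x < 0" using H by (auto simp: not_le)
    then have lt: "\<theta> + i * p + p < pi"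
      using Suc ge rot_angle_sign(1)[OF n, of "\<theta> + i * p"] by (auto simp: p_def)
    have "sin (\<theta> + i * p) > 0" using Suc ge by (intro sin_gt_zero) auto
    moreover have "sin (\<theta> + i * p + p) > 0" using lt ge p by (intro sin_gt_zero) auto
    moreover have "\<theta> + Suc i * p = \<theta> + i * p + p" by (simp add: algebra_simps)
    ultimately show ?case
      using Suc lt rot_rot_angle[of "\<theta> + i * p" n] unfolding p_def[symmetric] by (simp add: add.assoc)
  qed (use \<theta> in simp)
  obtain i :: nat where "pi / p < i" using reals_Archimedean2 by blast
  then have "pi < i * p" using p by (simp add: field_simps)
  then show False using it[of i] \<theta> by simp
qed

section \<open>Orbits that never meet\<close>

text \<open>The finite part of the orbit of \<open>\<infinity>\<close>; the last rule applied to 1 yields the junk value 0, which is harmless.\<close>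

inductive_set cusps :: "real \<Rightarrow> real set" for t where
  zero: "0 \<in> cusps t"
| plus: "x \<in> cusps t \<Longrightarrow> x + t \<in> cusps t"
| minus: "x \<in> cusps t \<Longrightarrow> x - t \<in> cusps t"
| inv: "x \<in> cusps t \<Longrightarrow> 1 / (1 - x) \<in> cusps t"

lemma countable_cusps: "countable (cusps t)"
proof -
  define step where "step S = (\<lambda>x. x + t) ` S \<union> (\<lambda>x. x - t) ` S \<union> (\<lambda>x. 1 / (1 - x)) ` S" for S
  define U where "U = (\<Union>i. (step ^^ i) {0})"
  have "countable ((step ^^ i) {0})" for i
    by (induction i) (auto simp: step_def)
  then have "countable U" unfolding U_def by (intro countable_UN) auto
  moreover have "x \<in> U" if "x \<in> cusps t" for x
    using that
  proof induction
    case zero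
    have "0 \<in> (step ^^ 0) {0}" by simp
    then show ?case unfolding U_def by blast
  next
    case (plus x)
    then obtain i where "x \<in> (step ^^ i) {0}" by (auto simp: U_def)
    then have "x + t \<in> (step ^^ Suc i) {0}" by (auto simp: step_def)
    then show ?case unfolding U_def by blast
  next
    case (minus x)
    then obtain i where "x \<in> (step ^^ i) {0}" by (auto simp: U_def)
    then have "x - t \<in> (step ^^ Suc i) {0}" by (auto simp: step_def)
    then show ?case unfolding U_def by blast
  next
    case (inv x)
    then obtain i where "x \<in> (step ^^ i) {0}" by (auto simp: U_def)
    then have "1 / (1 - x) \<in> (step ^^ Suc i) {0}" by (auto simp: step_def)
    then show ?case unfolding U_def by blast
  qed
  ultimately show ?thesis by (meson countable_subset subsetI)
qed

lemma cusps_shift: "x + of_int k * t \<in> cusps t \<longleftrightarrow> x \<in> cusps t"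
proof -
  have nat_shift: "x + real m * t \<in> cusps t \<and> x - real m * t \<in> cusps t" if "x \<in> cusps t" for x m
  proof (induction m)
    case (Suc m)
    have "x + real (Suc m) * t = x + real m * t + t" "x - real (Suc m) * t = x - real m * t - t"
      by (auto simp: algebra_simps)
    with Suc show ?case by (metis cusps.plus cusps.minus)
  qed (use that in simp)
  have shift: "x + of_int k * t \<in> cusps t" if "x \<in> cusps t" for x k
  proof (cases "k \<ge> 0")
    case True
    then show ?thesis using nat_shift[OF that, of "nat k"] by simp
  next
    case False
    then show ?thesis using nat_shift[OF that, of "nat (- k)"] by simp
  qed
  show ?thesis using shift[of x k] shift[of "x + of_int k * t" "- k"] by auto
qed

text \<open>The map in the rule \<open>inv\<close> is the square of \<open>C\<close>, and
  \<open>C\<close> has order three; so closure under \<open>inv\<close> alone controls both powers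
  of \<open>C\<close>.\<close>

lemma not_cusp:
  assumes "x \<notin> cusps t"
  shows "x \<noteq> 0" "x \<noteq> 1" "1 - 1 / x \<notin> cusps t" "1 / (1 - x) \<notin> cusps t"
proof -
  show x0: "x \<noteq> 0" using assms cusps.zero by auto
  show x1: "x \<noteq> 1" using assms cusps.inv[OF cusps.zero] by auto
  have "1 / (1 - (1 - 1 / x)) = x" by simp
  then show C: "1 - 1 / x \<notin> cusps t" using cusps.inv assms by metis
  have "1 / (1 - 1 / (1 - x)) = 1 - 1 / x" using x0 x1 by (simp add: field_simps)
  then show "1 / (1 - x) \<notin> cusps t" using cusps.inv C by metis
qed

text \<open>\<open>C\<close> moves a negative point by at least 3, which exceeds the length
  \<open>t\<close> of the interval.\<close>

lemma neg_gap:
  fixes x :: real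
  assumes "x < 0"
  shows "1 - 1 / x - x \<ge> 3"
proof -
  have "1 - 1 / x - x - 3 = (x + 1)\<^sup>2 / (- x)"
    using assms by (simp add: field_simps power2_eq_square)
  also have "\<dots> \<ge> 0" using assms by (intro divide_nonneg_pos) auto
  finally show ?thesis by simp
qed

text \<open>On \<open>[0, t)\<close> below 1 this is \<open>T_map n 1\<close>; above 1 it agrees with it when the power of \<open>A\<close> is 1.\<close>

definition first_map :: "real \<Rightarrow> real \<Rightarrow> real" where
  "first_map t x = (if x < 1 then 1 - 1 / x - t * of_int \<lfloor>(1 - 1 / x) / t\<rfloor> else t + 1 / (1 - x))"

text \<open>An exceptional \<alpha>. The assumption \<open>generic\<close> keeps both orbits away
  from \<infinity>, 0 and 1; the aim is \<open>first_map_orbit\<close>, which confines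
  \<open>r0\<close> to a null set.\<close>

locale no_synchronization =
  fixes n :: nat and \<alpha> :: real
  assumes n3: "n \<ge> 3" and \<alpha>: "0 < \<alpha>" "\<alpha> < 1"
    and generic: "r0 n \<alpha> \<notin> cusps (tval n)"
    and no_sync: "\<And>i j. (T_map n \<alpha> ^^ i) (Some (r0 n \<alpha>)) \<noteq> (T_map n \<alpha> ^^ j) (Some (ell0 n \<alpha>))"
begin

abbreviation "t \<equiv> tval n"
abbreviation "r \<equiv> r0 n \<alpha>"
abbreviation "l \<equiv> ell0 n \<alpha>"
abbreviation "I \<equiv> I_interval n \<alpha>"
abbreviation "T \<equiv> T_map n \<alpha>"

lemma t: "2 \<le> t" "t < 3" "t > 0"
  using tval_bounds[OF n3] by auto

lemma lr: "l = r - t" "0 < r" "r < t" "l < 0"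
  using t \<alpha> by (auto simp: ell0_def r0_def algebra_simps)

lemma I_iff: "x \<in> I \<longleftrightarrow> r - t \<le> x \<and> x < r"
  by (simp add: I_interval_def lr)

lemma I_unique:
  assumes "x \<in> I" "x + of_int k * t \<in> I"
  shows "k = 0"
proof -
  have "of_int k * t < 1 * t" "(- 1) * t < of_int k * t"
    using assms unfolding I_iff by linarith+
  then have "of_int k < (1::real)" "(-1::real) < of_int k"
    using t(3) mult_less_cancel_right_pos[of t] by blast+
  then show ?thesis by linarith
qed

section \<open>The two orbits and their classes modulo \<open>t\<close>\<close>

definition "left_orbit = {x. \<exists>j. (T ^^ j) (Some l) = Some x}"
definition "right_orbit = {x. \<exists>j. (T ^^ j) (Some r) = Some x}"
text \<open>This is the set \<open>R\<close>. Working modulo \<open>t\<close> loses nothing, since a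
  class meets \<open>I\<close> in one point only.\<close>

definition "left_classes = {x. \<exists>k::int. x + of_int k * t \<in> left_orbit}"

text \<open>The points whose first positive iterate under \<open>rot n\<close> (possibly the point itself) lies in \<open>left_classes\<close>.\<close>

inductive_set rot_classes where
  pos: "x \<in> left_classes \<Longrightarrow> 0 < x \<Longrightarrow> x \<in> rot_classes"
| neg: "rot n x \<in> rot_classes \<Longrightarrow> x < 0 \<Longrightarrow> x \<in> rot_classes"

lemma C_neg:
  assumes "r - t \<le> x" "x < 0"
  shows "1 - 1 / x \<notin> I"
  using neg_gap[OF assms(2)] assms t by (auto simp: I_iff)

lemma C_eq_D:
  fixes x :: real
  assumes "x \<noteq> 0" "x \<noteq> 1"
  shows "1 - 1 / (1 - 1 / x) = 1 / (1 - x)" "1 - 1 / (1 / (1 - x)) = x"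
    "1 / (1 - 1 / (1 - x)) = 1 - 1 / x"
  using assms by (auto simp: field_simps)

lemma D_unit:
  assumes "0 < x" "x < 1" "1 - 1 / x \<in> I"
  shows "1 / (1 - x) \<notin> I"
proof -
  have "1 - 1 / x < 0" using assms by (simp add: field_simps)
  then show ?thesis using C_neg[of "1 - 1 / x"] assms C_eq_D[of x] by (auto simp: I_iff)
qed

text \<open>\<open>1 / (1 - x)\<close> is the negative point that \<open>C\<close> sends to
  \<open>x\<close>, so \<open>neg_gap\<close> at that point places it to the left of
  \<open>I\<close>.\<close>

lemma CD_big:
  assumes "1 < x" "x \<le> r"
  shows "1 - 1 / x \<in> I" "1 / (1 - x) \<notin> I" "1 / (1 - x) < r - t"
proof -
  have "0 < 1 - 1 / x" "1 - 1 / x < 1" using assms by (auto simp: field_simps)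
  then show "1 - 1 / x \<in> I" using assms lr unfolding I_iff by linarith
  have neg: "1 / (1 - x) < 0" using assms by (simp add: field_simps)
  have "x - 1 / (1 - x) \<ge> 3" using neg_gap[OF neg] C_eq_D[of x] assms by simp
  then show "1 / (1 - x) < r - t" using assms t by simp
  then show "1 / (1 - x) \<notin> I" by (simp add: I_iff)
qed

text \<open>The exponent of \<open>C\<close> is 1 at negative points by \<open>C_neg\<close>, 2
  above 1 by \<open>CD_big\<close>, and at most 2 in between by \<open>D_unit\<close>.\<close>

lemma T_ex:
  assumes "x \<notin> cusps t" "r - t \<le> x" "x \<le> r"
  shows "\<exists>y. T (Some x) = Some y \<and> y \<in> I \<and> y \<notin> cusps t"
proof (cases "1 - 1 / x \<in> I")
  case False
  then obtain k :: int where "T (Some x) = Some (1 - 1 / x + of_int k * t)" "1 - 1 / x + of_int k * t \<in> I"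
    using T_map_C[OF t(3)] not_cusp[OF assms(1)] by blast
  then show ?thesis using not_cusp[OF assms(1)] cusps_shift by auto
next
  case True
  then have "1 / (1 - x) \<notin> I"
    using C_neg[of x] D_unit[of x] CD_big(2)[of x] not_cusp[OF assms(1)] assms
    by (cases x "0::real" rule: linorder_cases; cases x "1::real" rule: linorder_cases) auto
  then obtain k :: int where "T (Some x) = Some (1 / (1 - x) + of_int k * t)" "1 / (1 - x) + of_int k * t \<in> I"
    using T_map_CC[OF t(3)] not_cusp[OF assms(1)] True by blast
  then show ?thesis using not_cusp[OF assms(1)] cusps_shift by auto
qed

lemma orbit_in_I:
  assumes "x \<notin> cusps t" "r - t \<le> x" "x \<le> r" "(T ^^ j) (Some x) = Some y"
  shows "y \<notin> cusps t \<and> (if j = 0 then y = x else y \<in> I)"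
  using assms(4)
proof (induction j arbitrary: y)
  case (Suc j)
  obtain z where z: "(T ^^ j) (Some x) = Some z"
    using Suc.prems by (cases "(T ^^ j) (Some x)") (auto simp: T_map_def[of n \<alpha> None])
  have "z \<notin> cusps t" "r - t \<le> z" "z \<le> r"
    using Suc.IH[OF z] assms by (auto simp: I_iff split: if_splits)
  from T_ex[OF this] Suc.prems z show ?case by auto
qed (use assms in auto)

lemma l_generic: "l \<notin> cusps t"
  using generic cusps_shift[of r "-1" t] by (simp add: lr)

lemma left_orbit: "x \<in> left_orbit \<Longrightarrow> x \<in> I \<and> x \<notin> cusps t"
proof -
  assume "x \<in> left_orbit"
  then obtain j where "(T ^^ j) (Some l) = Some x" by (auto simp: left_orbit_def)
  moreover have "l \<in> I" using lr by (simp add: I_iff)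
  ultimately show ?thesis
    using orbit_in_I[OF l_generic, of j x] lr by (auto split: if_splits)
qed

lemma right_orbit: "x \<in> right_orbit \<Longrightarrow> (x = r \<or> x \<in> I) \<and> x \<notin> cusps t"
proof -
  assume "x \<in> right_orbit"
  then obtain j where "(T ^^ j) (Some r) = Some x" by (auto simp: right_orbit_def)
  from orbit_in_I[OF generic _ _ this] t show ?thesis by (auto split: if_splits)
qed

lemma T_left_orbit: "x \<in> left_orbit \<Longrightarrow> T (Some x) = Some y \<Longrightarrow> y \<in> left_orbit"
proof -
  assume "x \<in> left_orbit" and y: "T (Some x) = Some y"
  then obtain j where "(T ^^ j) (Some l) = Some x" by (auto simp: left_orbit_def)
  then have "(T ^^ Suc j) (Some l) = Some y" using y by simp
  then show ?thesis unfolding left_orbit_def by blast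
qed

lemma T_right_orbit: "x \<in> right_orbit \<Longrightarrow> T (Some x) = Some y \<Longrightarrow> y \<in> right_orbit"
proof -
  assume "x \<in> right_orbit" and y: "T (Some x) = Some y"
  then obtain j where "(T ^^ j) (Some r) = Some x" by (auto simp: right_orbit_def)
  then have "(T ^^ Suc j) (Some r) = Some y" using y by simp
  then show ?thesis unfolding right_orbit_def by blast
qed

lemma left_classes_shift: "x + of_int k * t \<in> left_classes \<longleftrightarrow> x \<in> left_classes"
proof -
  have *: "x + of_int k * t \<in> left_classes" if x: "x \<in> left_classes" for x k
  proof -
    obtain m :: int where "x + of_int m * t \<in> left_orbit" using x by (auto simp: left_classes_def)
    moreover have "x + of_int m * t = x + of_int k * t + of_int (m - k) * t" by (simp add: algebra_simps)
    ultimately show ?thesis unfolding left_classes_def by (metis (mono_tags) mem_Collect_eq)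
  qed
  show ?thesis using *[of x k] *[of "x + of_int k * t" "- k"] by auto
qed

lemma left_classes_minus: "x - t \<in> left_classes \<longleftrightarrow> x \<in> left_classes"
  using left_classes_shift[of x "-1"] by simp

lemma left_classes_I: "x \<in> left_classes \<Longrightarrow> x \<in> I \<Longrightarrow> x \<in> left_orbit"
proof -
  assume x: "x \<in> left_classes" "x \<in> I"
  then obtain k :: int where k: "x + of_int k * t \<in> left_orbit" by (auto simp: left_classes_def)
  then have "k = 0" using I_unique[OF x(2)] left_orbit by blast
  then show ?thesis using k by simp
qed

lemma left_orbit_classes: "x \<in> left_orbit \<Longrightarrow> x \<in> left_classes"
  unfolding left_classes_def by (auto intro: exI[of _ 0])

lemma left_classes_generic: "x \<in> left_classes \<Longrightarrow> x \<notin> cusps t"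
  using left_orbit cusps_shift[of x _ t] unfolding left_classes_def by blast

lemma left_classes_C:
  assumes "x \<in> left_classes" "x \<in> I" "1 - 1 / x \<notin> I"
  shows "1 - 1 / x \<in> left_classes"
proof -
  obtain k :: int where "T (Some x) = Some (1 - 1 / x + of_int k * t)"
    using T_map_C[OF t(3) _ assms(3)] not_cusp(1)[OF left_classes_generic[OF assms(1)]] by auto
  then have "1 - 1 / x + of_int k * t \<in> left_classes"
    by (intro left_orbit_classes T_left_orbit[OF left_classes_I[OF assms(1,2)]])
  then show ?thesis by (simp only: left_classes_shift)
qed

lemma left_classes_CC:
  assumes "x \<in> left_classes" "x \<in> I" "1 - 1 / x \<in> I" "1 / (1 - x) \<notin> I"
  shows "1 / (1 - x) \<in> left_classes"
proof -
  obtain k :: int where "T (Some x) = Some (1 / (1 - x) + of_int k * t)"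
    using T_map_CC[OF t(3) _ _ assms(3,4)] not_cusp(1,2)[OF left_classes_generic[OF assms(1)]] by auto
  then have "1 / (1 - x) + of_int k * t \<in> left_classes"
    by (intro left_orbit_classes T_left_orbit[OF left_classes_I[OF assms(1,2)]])
  then show ?thesis by (simp only: left_classes_shift)
qed

section \<open>Consequences of the orbits never meeting\<close>

lemma no_meet: "x \<in> right_orbit \<Longrightarrow> x \<in> I \<Longrightarrow> x \<notin> left_classes"
proof
  assume "x \<in> right_orbit" "x \<in> I" "x \<in> left_classes"
  then obtain i j where "(T ^^ i) (Some r) = Some x" "(T ^^ j) (Some l) = Some x"
    using left_classes_I unfolding left_orbit_def right_orbit_def by blast
  then show False using no_sync[of i j] by simp
qed

text \<open>On negative points of \<open>I\<close> the map is \<open>rot n\<close> up to a multiple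
  of \<open>t\<close>, and \<open>neg_gap\<close> gives \<open>rot n x \<ge> r - t\<close>. So the
  iterates stay in \<open>left_classes\<close> until, by \<open>rot_escape\<close>, they turn
  positive.\<close>

lemma left_classes_rot_classes:
  assumes "x \<in> left_classes" "r - t \<le> x" "x < 0"
  shows "x \<in> rot_classes"
proof -
  obtain i where "(rot n ^^ i) x \<ge> 0" using rot_escape[of n x] n3 by auto
  then show ?thesis using assms
  proof (induction i arbitrary: x)
    case (Suc i)
    have "x \<in> I" using Suc.prems lr by (simp add: I_iff)
    then have C: "1 - 1 / x \<in> left_classes"
      using C_neg[of x] left_classes_C[of x] Suc.prems by simp
    have "1 - 1 / x \<ge> r" using neg_gap[of x] Suc.prems t by simp
    then have ge: "rot n x \<ge> r - t" by (simp add: rot_def)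
    have R: "rot n x \<in> left_classes" using C left_classes_minus by (simp add: rot_def)
    then have "rot n x \<noteq> 0" using left_classes_generic not_cusp(1) by blast
    moreover have "rot n x \<in> rot_classes" if "rot n x < 0"
      by (rule Suc.IH) (use Suc.prems(1) R ge that in \<open>auto simp: funpow_swap1\<close>)
    ultimately show ?case
      using R Suc.prems rot_classes.neg[of x] rot_classes.pos[of "rot n x"] by linarith
  qed simp
qed

text \<open>The \<open>rot n\<close>-orbit of \<open>x\<close> closes up after \<open>n\<close>
  steps with only negative points in between, so the first positive point after \<open>x\<close> is
  \<open>x\<close> itself.\<close>

lemma rot_cycle_left_classes:
  assumes "x > 0" "rot n x \<in> rot_classes"
  shows "x \<in> left_classes"
proof -
  have n2: "n \<ge> 2" using n3 by simp
  have "(rot n ^^ Suc i) x \<in> rot_classes" if "Suc i \<le> n" for i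
    using that
  proof (induction i)
    case (Suc i)
    then have "(rot n ^^ Suc i) x < 0" using rot_cycle(2)[OF n2 assms(1), of "Suc i"] by simp
    moreover have "(rot n ^^ Suc i) x \<in> rot_classes" using Suc by simp
    ultimately have "rot n ((rot n ^^ Suc i) x) \<in> rot_classes" by (auto elim: rot_classes.cases)
    then show ?case by simp
  qed (use assms in simp)
  from this[of "n - 1"] have "x \<in> rot_classes" using rot_cycle(1)[OF n2 assms(1)] n3 by simp
  then show ?thesis using assms by (auto elim: rot_classes.cases)
qed

text \<open>A negative representative \<open>u\<close> of \<open>y\<close> forces its preimage
  \<open>z\<close> under \<open>C\<close> and its image \<open>C u\<close> into
  \<open>left_classes\<close>, so the orbits would meet unless \<open>u\<close> lies to the left of
  \<open>I\<close>. The conclusion supplies the same hypotheses for \<open>u + t\<close>.\<close>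

lemma negative_rot_classes:
  assumes y: "y \<in> right_orbit" "y \<in> I" "u = y + of_int k * t"
    and u: "u < r" "u < 0" "u - t \<in> rot_classes"
  shows "r < 1 \<and> u < r - t \<and> u \<in> rot_classes"
proof -
  define z where "z = 1 / (1 - u)"
  have z: "0 < z" "z < 1" using u by (auto simp: z_def field_simps)
  have Cz: "1 - 1 / z = u" "1 / (1 - z) = 1 - 1 / u" using u C_eq_D[of u] by (auto simp: z_def)
  have yu: "y \<in> left_classes" if "u \<in> left_classes"
    using that left_classes_shift y(3) by blast
  have uR: "u \<notin> left_classes" using yu no_meet y by blast
  have zR: "z \<in> left_classes"
    by (rule rot_cycle_left_classes) (use z Cz u in \<open>auto simp: rot_def\<close>)
  have u_eq: "u = y" if "u \<in> I" using I_unique[OF y(2)] y(3) that by auto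
  have uT: "1 - 1 / u \<notin> left_classes" if "u \<in> I"
  proof
    assume C: "1 - 1 / u \<in> left_classes"
    have "1 - 1 / u \<notin> I" using C_neg[of u] u that by (simp add: I_iff)
    then obtain k :: int where "T (Some u) = Some (1 - 1 / u + of_int k * t)" "1 - 1 / u + of_int k * t \<in> I"
      using T_map_C[OF t(3), of u] u by auto
    then show False using T_right_orbit[of u] no_meet C left_classes_shift[of "1 - 1 / u" k] u_eq[OF that] y(1) by simp
  qed
  \<comment> \<open>Were \<open>z\<close> in \<open>I\<close>, the orbit of \<open>ell0\<close>
    would pass from \<open>z\<close> to the class of \<open>u\<close>, or of \<open>C u\<close> if
    \<open>u\<close> lies in \<open>I\<close> as well; both are excluded.\<close>
  have zr: "z \<ge> r"
  proof (rule ccontr)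
    assume "\<not> z \<ge> r"
    then have zI: "z \<in> I" using z lr by (simp add: I_iff)
    show False
    proof (cases "u \<in> I")
      case False
      then show False using left_classes_C[OF zR zI] Cz uR by simp
    next
      case True
      then have "1 / (1 - z) \<notin> I" using D_unit[OF z] Cz by simp
      then show False using left_classes_CC[OF zR zI] Cz True uT by simp
    qed
  qed
  have "z - t \<in> rot_classes"
    by (rule left_classes_rot_classes) (use zR z zr t left_classes_minus in auto)
  moreover have "rot n (1 - 1 / u) = z - t"
    using C_eq_D[of u] u by (simp add: rot_def z_def)
  moreover have "1 - 1 / u > 0" using u by (simp add: field_simps)
  ultimately have Cu: "1 - 1 / u \<in> left_classes" using rot_cycle_left_classes by auto
  then have "u \<notin> I" using uT by blast
  then have ul: "u < r - t" using u by (simp add: I_iff)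
  \<comment> \<open>This puts \<open>C u\<close> into \<open>(1, 2)\<close>, so
    \<open>rot n u = C u - t\<close> lies in \<open>[r - t, 0)\<close> and
    \<open>left_classes_rot_classes\<close> applies to it.\<close>
  then have "u < - 1" using ul zr z t by simp
  then have "1 < 1 - 1 / u" "1 - 1 / u < 2" by (auto simp: field_simps)
  then have "r - t \<le> 1 - 1 / u - t" "1 - 1 / u - t < 0" using zr z t by linarith+
  then have "1 - 1 / u - t \<in> rot_classes"
    by (intro left_classes_rot_classes) (simp_all only: Cu left_classes_minus)
  then show ?thesis using u ul zr z by (auto simp: rot_def intro: rot_classes.neg)
qed

text \<open>Translate \<open>u\<close> by \<open>t\<close> until it is positive:
  \<open>negative_rot_classes\<close> preserves the hypotheses, and a positive translate below
  \<open>r\<close> lies in \<open>I\<close>, hence is \<open>y\<close>. For \<open>r \<ge> 1\<close>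
  no translation can occur, which fixes the power of \<open>A\<close> in the branch of
  \<open>first_map\<close> above 1.\<close>

lemma ascend:
  assumes y: "y \<in> right_orbit" "y \<in> I" "u = y + of_int k * t"
    and u: "u < r" "u - t \<in> rot_classes"
  shows "\<exists>m::nat. y = u + m * t \<and> 0 < u + m * t \<and> y - t \<in> rot_classes \<and> (r \<ge> 1 \<longrightarrow> y = u)"
proof -
  obtain N :: nat where "- u / t < N" using reals_Archimedean2 by blast
  then have "u + N * t > 0" using t by (simp add: field_simps)
  then show ?thesis using y u
  proof (induction N arbitrary: u k)
    case 0
    then have "u \<in> I" using lr by (simp add: I_iff)
    then have "k = 0" using I_unique[OF y(2)] 0 by simp
    then show ?case using 0 by (intro exI[of _ 0]) auto
  next
    case (Suc N)
    have u0: "u \<noteq> 0"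
      using right_orbit[OF y(1)] not_cusp(1)[of u t] cusps_shift[of y k t] Suc.prems by simp
    show ?case
    proof (cases "u > 0")
      case True
      then have "u \<in> I" using lr Suc.prems by (simp add: I_iff)
      then have "k = 0" using I_unique[OF y(2)] Suc.prems by simp
      then show ?thesis using Suc.prems True by (intro exI[of _ 0]) auto
    next
      case False
      then have u: "u < 0" using u0 by simp
      from negative_rot_classes[OF Suc.prems(2-5) u Suc.prems(6)]
      have *: "r < 1" "u \<in> rot_classes" "u < r - t" by auto
      have "u + t < r" using *(3) by simp
      moreover have "u + t = y + of_int (k + 1) * t" using Suc.prems by (simp add: algebra_simps)
      ultimately obtain m :: nat where "y = u + t + m * t" "0 < u + t + m * t" "y - t \<in> rot_classes"
        using Suc.IH[of "u + t" "k + 1"] Suc.prems * by (auto simp: algebra_simps)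
      then show ?thesis using * by (intro exI[of _ "Suc m"]) (auto simp: algebra_simps)
    qed
  qed
qed

text \<open>In both cases \<open>ascend\<close> applies to \<open>u\<close>, the image of
  \<open>x\<close> under the relevant power of \<open>C\<close>, translated once by
  \<open>t\<close>. Above 1, \<open>rot n (u - t)\<close> is \<open>x - t\<close>; below 1, it is
  \<open>X - t\<close> with \<open>X\<close> in \<open>left_classes\<close>.\<close>

lemma first_map_step:
  assumes x: "x \<in> right_orbit" "0 < x" "x \<le> r" "x - t \<in> rot_classes"
  defines "y \<equiv> first_map t x"
  shows "y \<in> right_orbit" "0 < y" "y \<le> r" "y - t \<in> rot_classes"
proof -
  have gx: "x \<notin> cusps t" using right_orbit x(1) by blast
  note nc = not_cusp[OF gx]
  have xl: "r - t \<le> x" using x lr by simp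
  obtain y' where y': "T (Some x) = Some y'" "y' \<in> I" using T_ex[OF gx xl x(3)] by blast
  have orb: "y' \<in> right_orbit" using T_right_orbit x(1) y'(1) by blast
  have "y' = y \<and> 0 < y' \<and> y' - t \<in> rot_classes"
  proof (cases "x < 1")
    case False
    then have x1: "1 < x" using nc by simp
    note CD = CD_big[OF x1 x(3)]
    define u where "u = 1 / (1 - x) + t"
    obtain k :: int where "T (Some x) = Some (1 / (1 - x) + of_int k * t)"
      using T_map_CC[OF t(3) nc(1,2) CD(1,2)] by blast
    then have "y' = 1 / (1 - x) + of_int k * t" using y'(1) by simp
    then have uy: "u = y' + of_int (1 - k) * t" by (simp add: u_def algebra_simps)
    have "rot n (u - t) = x - t" by (simp add: u_def rot_def)
    moreover have "u - t < 0" using x1 by (simp add: u_def field_simps)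
    ultimately have uQ: "u - t \<in> rot_classes" using x(4) rot_classes.neg[of "u - t"] by simp
    have "u < r" using CD(3) by (simp add: u_def)
    from ascend[OF orb y'(2) uy this uQ] obtain m :: nat
      where m: "y' = u + m * t" "0 < u + m * t" "y' - t \<in> rot_classes" "r \<ge> 1 \<longrightarrow> y' = u"
      by (elim exE conjE) (rule that)
    have "y' = u" using x1 x(3) m(4) by simp
    moreover have "y = u" using False by (simp add: y_def first_map_def u_def)
    ultimately show ?thesis using m(1-3) by simp
  next
    case x1: True
    define X where "X = 1 / (1 - x)"
    define v where "v = 1 - 1 / x"
    have v: "v < 0" using x1 x(2) by (simp add: v_def field_simps)
    have X: "1 < X" using x1 x(2) by (simp add: X_def field_simps)
    have CX: "1 - 1 / X = x" "1 / (1 - X) = v" using C_eq_D(3)[OF nc(1,2)] by (simp_all add: X_def v_def)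
    have rv: "rot n v = X - t" using C_eq_D(1)[OF nc(1,2)] by (simp add: X_def v_def rot_def)
    have XR: "X \<in> left_classes"
      by (rule rot_cycle_left_classes) (use X CX(1) x(4) in \<open>simp_all add: rot_def\<close>)
    have vI: "v \<notin> I"
    proof
      assume *: "v \<in> I"
      then have "X \<notin> I" using D_unit[OF x(2) x1] by (simp add: v_def X_def)
      then obtain k :: int where "T (Some x) = Some (X + of_int k * t)"
        using T_map_CC[OF t(3) nc(1,2), of \<alpha>] * unfolding X_def v_def by blast
      then have "y' = X + of_int k * t" using y'(1) by simp
      then show False using no_meet[OF orb y'(2)] XR left_classes_shift[of X k] by simp
    qed
    obtain k :: int where "T (Some x) = Some (v + of_int k * t)"
      using T_map_C[OF t(3) nc(1), of \<alpha>] vI unfolding v_def by blast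
    then have k: "y' = v + of_int k * t" using y'(1) by simp
    have vR: "v \<notin> left_classes" using no_meet[OF orb y'(2)] left_classes_shift[of v k] k by simp
    \<comment> \<open>Otherwise the orbit of \<open>ell0\<close> goes from \<open>X\<close> past
      \<open>C X = x\<close>, still in \<open>I\<close>, to the class of \<open>v\<close>, where the
      orbit of \<open>r0\<close> arrives too.\<close>
    have "X \<ge> r"
    proof (rule ccontr)
      assume "\<not> X \<ge> r"
      then have Xr: "X < r" by simp
      have "X \<in> I" using Xr X lr unfolding I_iff by linarith
      moreover have "x \<in> I" using Xr X x1 xl unfolding I_iff by linarith
      ultimately show False using left_classes_CC[OF XR] CX vI vR by simp
    qed
    have XQ: "X - t \<in> rot_classes"
    proof (cases "X - t < 0")
      case True
      then show ?thesis
        using left_classes_rot_classes[of "X - t"] XR \<open>X \<ge> r\<close> left_classes_minus by simp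
    next
      case False
      have "X - t \<in> left_classes" using XR left_classes_minus by simp
      moreover have "X - t \<noteq> 0" using not_cusp(1)[OF left_classes_generic[OF calculation]] .
      ultimately show ?thesis using False by (intro rot_classes.pos) auto
    qed
    define u where "u = v + t"
    have uQ: "u - t \<in> rot_classes" using XQ rv v rot_classes.neg[of v] by (simp add: u_def)
    have ur: "u < r" using vI v lr by (simp add: u_def I_iff)
    have "u = y' + of_int (1 - k) * t" by (simp add: u_def k algebra_simps)
    from ascend[OF orb y'(2) this ur uQ] obtain m :: nat
      where m: "y' = u + m * t" "0 < u + m * t" "y' - t \<in> rot_classes"
      by (elim exE conjE) (rule that)
    have y'v: "y' = v + (m + 1) * t" using m by (simp add: u_def algebra_simps)
    have "0 < y'" "y' < t" using m y'(2) lr by (auto simp: I_iff)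
    then have "- real (m + 1) \<le> v / t" "v / t < - real (m + 1) + 1"
      using t unfolding y'v by (auto simp: field_simps)
    then have fl: "\<lfloor>v / t\<rfloor> = - int (m + 1)" by (intro floor_unique) auto
    have "y = y'" using x1 y'v unfolding y_def first_map_def v_def[symmetric] fl by (simp add: algebra_simps)
    then show ?thesis using m by simp
  qed
  then show "y \<in> right_orbit" "0 < y" "y \<le> r" "y - t \<in> rot_classes"
    using orb y' by (auto simp: I_iff)
qed

lemma first_map_orbit:
  "(first_map t ^^ m) r \<in> {0<..r} - {1}"
proof -
  define P where "P x \<longleftrightarrow> x \<in> right_orbit \<and> 0 < x \<and> x \<le> r \<and> x - t \<in> rot_classes" for x
  have "r \<in> right_orbit" by (auto simp: right_orbit_def intro: exI[of _ 0])
  moreover have "l \<in> left_orbit" by (auto simp: left_orbit_def intro: exI[of _ 0])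
  then have "r - t \<in> rot_classes"
    using left_classes_rot_classes[of l] left_orbit_classes lr by simp
  ultimately have "P r" using lr by (simp add: P_def)
  then have "P ((first_map t ^^ m) r)"
  proof (induction m)
    case (Suc m)
    then show ?case using first_map_step[of "(first_map t ^^ m) r"] by (simp add: P_def)
  qed simp
  then show ?thesis using right_orbit not_cusp(2) by (auto simp: P_def)
qed

end

section \<open>A null set\<close>

text \<open>Used for one increasing branch \<open>g\<close> at a time, with \<open>w\<close> and
  \<open>f\<close> the invariant measures of the fibres above a point and above its image.\<close>

lemma nn_integral_substitution_on:
  fixes f w :: "real \<Rightarrow> real" and g g' :: "real \<Rightarrow> real"
  assumes [measurable]: "f \<in> borel_measurable borel" and f: "\<And>x. f x \<ge> 0"
    and g: "\<And>x. x \<in> {a..b} \<Longrightarrow> (g has_real_derivative g' x) (at x)"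
    and g': "continuous_on {a..b} g'" "\<And>x. x \<in> {a..b} \<Longrightarrow> g' x \<ge> 0" and "a \<le> b"
    and D: "D \<subseteq> {a..b}" "\<And>x. x \<in> D \<Longrightarrow> w x \<le> f (g x) * g' x"
  shows "(\<integral>\<^sup>+x. ennreal (w x) * indicator D x \<partial>lborel) \<le> (\<integral>\<^sup>+x. ennreal (f x) \<partial>lborel)"
proof -
  have "(\<integral>\<^sup>+x. ennreal (w x) * indicator D x \<partial>lborel)
      \<le> (\<integral>\<^sup>+x. f (g x) * g' x * indicator {a..b} x \<partial>lborel)"
    using D f g' by (intro nn_integral_mono) (auto split: split_indicator intro!: ennreal_leI)
  also have "\<dots> = (\<integral>\<^sup>+x. f x * indicator {g a..g b} x \<partial>lborel)"
    by (rule nn_integral_substitution[symmetric])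
       (use g g' \<open>a \<le> b\<close> in \<open>auto simp: set_borel_measurable_def\<close>)
  also have "\<dots> \<le> (\<integral>\<^sup>+x. ennreal (f x) \<partial>lborel)"
    using f by (intro nn_integral_mono ennreal_leI) (auto split: split_indicator)
  finally show ?thesis .
qed

text \<open>The brackets are the integrals of \<open>dp / (p - y)^2\<close> over the intervals
  \<open>(k t, k t + 1)\<close> and \<open>(t + 1, 2 t)\<close>, which are disjoint parts of
  \<open>(t, \<infinity>)\<close>; the right-hand side is the integral over all of it.\<close>

lemma digit_sum_le:
  fixes t y :: real
  assumes "t > 1" "y < t"
  shows "(\<Sum>k<m. 1 / (real (Suc k) * t - y) - 1 / (real (Suc k) * t + 1 - y))
      + (1 / (t + 1 - y) - 1 / (2 * t - y)) \<le> 1 / (t - y)"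
proof -
  \<comment> \<open>The first interval and the gap fill \<open>(t, 2 t)\<close>, so the induction
    compares with the integral over \<open>(t, (m + 2) t)\<close>.\<close>
  have "(\<Sum>k<Suc m. 1 / (real (Suc k) * t - y) - 1 / (real (Suc k) * t + 1 - y))
      + (1 / (t + 1 - y) - 1 / (2 * t - y)) \<le> 1 / (t - y) - 1 / (real (Suc (Suc m)) * t - y)" for m
  proof (induction m)
    case (Suc m)
    let ?s = "real (Suc (Suc m)) * t"
    have "1 * t \<le> real (Suc (Suc m)) * t" using assms by (intro mult_right_mono) auto
    then have "0 < ?s + 1 - y" using assms by linarith
    moreover have "?s + 1 - y \<le> real (Suc (Suc (Suc m))) * t - y" using assms by (simp add: algebra_simps)
    ultimately have "1 / (real (Suc (Suc (Suc m))) * t - y) \<le> 1 / (?s + 1 - y)"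
      by (intro divide_left_mono mult_pos_pos) auto
    then show ?case using Suc.IH by (simp only: sum.lessThan_Suc[of _ "Suc m"])
  qed simp
  note le = this
  show ?thesis
  proof (cases m)
    case 0
    have "1 / (t + 1 - y) \<le> 1 / (t - y)" "0 < 1 / (2 * t - y)"
      using assms by (auto intro!: divide_left_mono mult_pos_pos)
    then have "1 / (t + 1 - y) - 1 / (2 * t - y) \<le> 1 / (t - y)" by linarith
    then show ?thesis using 0 by simp
  next
    case (Suc m')
    have "1 * t \<le> real (Suc (Suc m')) * t" using assms by (intro mult_right_mono) auto
    then have "y < real (Suc (Suc m')) * t" using assms by linarith
    then have "0 < 1 / (real (Suc (Suc m')) * t - y)" by simp
    then show ?thesis unfolding Suc using le[of m'] by linarith
  qed
qed

text \<open>
  Above \<open>x \<in> F i\<close> sit the \<open>p > \<beta> i\<close>, so that \<open>a i\<close> is the invariant measure of the pairs above \<open>F i\<close> and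
  \<open>c i\<close> that of the pairs with \<open>p > t\<close>. The branch above 1 sends \<open>F (i + 1)\<close> into \<open>F i\<close> and the
  half-line above \<open>\<beta> (i + 1)\<close> to \<open>(\<beta> i, t)\<close>; the branches below 1 send \<open>(1, \<infinity>)\<close> to the
  disjoint intervals \<open>(k t, k t + 1)\<close>.
\<close>

lemma invariant_set_null:
  fixes t q :: real and \<beta> :: "nat \<Rightarrow> real" and N :: nat
  assumes t2: "t \<ge> 2" and [measurable]: "E \<in> sets borel" and E: "E \<subseteq> {0<..<t}" "1 \<notin> E"
    and q: "q < 1" "\<And>x. x \<in> E \<Longrightarrow> x < 1 \<Longrightarrow> x \<le> q"
    and small: "\<And>x. x \<in> E \<Longrightarrow> x < 1 \<Longrightarrow> \<exists>k. 1 - 1 / x + real (Suc k) * t \<in> E"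
    and big: "\<And>x. x \<in> E \<Longrightarrow> 1 < x \<Longrightarrow> t + 1 / (1 - x) \<in> E"
    and \<beta>: "\<beta> 0 = 1" "\<beta> N = t" "\<And>i. i < N \<Longrightarrow> \<beta> i < t" "\<And>i. i < N \<Longrightarrow> \<beta> (Suc i) = 1 + 1 / (t - \<beta> i)"
  shows "E \<in> null_sets lborel"
proof -
  have t: "t > 1" using t2 by simp
  define F where "F i = {x \<in> E. x < \<beta> i \<and> (i = 0 \<or> \<beta> (i - 1) \<le> x)}" for i
  have F[measurable]: "F i \<in> sets borel" for i unfolding F_def by measurable
  define a where "a i = (\<integral>\<^sup>+x. ennreal (1 / (\<beta> i - x)) * indicator (F i) x \<partial>lborel)" for i
  define c where "c i = (\<integral>\<^sup>+x. ennreal (1 / (t - x)) * indicator (F i) x \<partial>lborel)" for i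
  have E_bd: "0 < x" "x < t" "x \<noteq> 1" if "x \<in> E" for x using E that by auto
  have \<beta>1: "\<beta> i \<ge> 1" if "i \<le> N" for i
  proof (cases i)
    case (Suc j)
    then have "1 / (t - \<beta> j) > 0" "\<beta> i = 1 + 1 / (t - \<beta> j)" using \<beta>(3,4)[of j] that by auto
    then show ?thesis by linarith
  qed (simp add: \<beta>)

  have rotate: "a (Suc i) + c i \<le> a i" if i: "i < N" for i
  proof -
    define f where "f y = (1 / (\<beta> i - y) - 1 / (t - y)) * indicator (F i) y" for y
    have f0: "f y \<ge> 0" for y
    proof (cases "y \<in> F i")
      case True
      then have "1 / (t - y) \<le> 1 / (\<beta> i - y)"
        using \<beta>(3)[OF i] by (intro divide_left_mono mult_pos_pos) (auto simp: F_def)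
      then show ?thesis by (simp add: f_def)
    qed (simp add: f_def)
    \<comment> \<open>The branch value is nonnegative from \<open>1 + 1 / t\<close> on, so the
      interval of substitution contains \<open>F (Suc i)\<close> and avoids the pole at 1.\<close>
    have "a (Suc i) \<le> (\<integral>\<^sup>+x. ennreal (f x) \<partial>lborel)"
      unfolding a_def
    proof (rule nn_integral_substitution_on[where a = "1 + 1 / t" and b = t
          and g = "\<lambda>x. t + 1 / (1 - x)" and g' = "\<lambda>x. 1 / (1 - x)\<^sup>2"])
      show "f \<in> borel_measurable borel" unfolding f_def by measurable
      fix x assume "x \<in> {1 + 1 / t..t}"
      moreover have "1 / t > 0" using t by simp
      ultimately have "1 - x \<noteq> 0" by auto
      then show "((\<lambda>x. t + 1 / (1 - x)) has_real_derivative 1 / (1 - x)\<^sup>2) (at x)"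
        by (auto intro!: derivative_eq_intros simp: power2_eq_square)
    next
      have "1 / t > 0" using t by simp
      then show "continuous_on {1 + 1 / t..t} (\<lambda>x. 1 / (1 - x)\<^sup>2)"
        by (intro continuous_intros) auto
    next
      have mem: "1 < x \<and> t + 1 / (1 - x) \<in> F i \<and> 1 + 1 / t \<le> x \<and> x < \<beta> (Suc i)" if "x \<in> F (Suc i)" for x
      proof -
        have x: "x \<in> E" "x < \<beta> (Suc i)" "\<beta> i \<le> x" using that by (auto simp: F_def)
        have x1: "1 < x" using \<beta>1[of i] x i E_bd[of x] by fastforce
        have VE: "t + 1 / (1 - x) \<in> E" using big x x1 by blast
        have eq: "1 / (1 - x) = - (1 / (x - 1))" by (metis minus_diff_eq divide_minus_right)
        have "1 / t < x - 1" using E_bd[OF VE] x1 t eq by (simp add: field_simps)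
        moreover have "t + 1 / (1 - x) < \<beta> i"
          using x \<beta>(3,4)[OF i] x1 unfolding eq by (simp add: field_simps)
        moreover have "\<beta> (i - 1) \<le> t + 1 / (1 - x)" if "i \<noteq> 0"
        proof -
          have "1 + 1 / (t - \<beta> (i - 1)) \<le> x" "\<beta> (i - 1) < t"
            using \<beta>(3,4)[of "i - 1"] i that x by auto
          then show ?thesis using x1 unfolding eq by (simp add: field_simps)
        qed
        ultimately show ?thesis using x x1 VE by (auto simp: F_def)
      qed
      have "1 / t \<le> 1" using t by simp
      then show "1 + 1 / t \<le> t" using t2 by linarith
      show "F (Suc i) \<subseteq> {1 + 1 / t..t}" using mem E_bd by (force simp: F_def)
      fix x assume xF: "x \<in> F (Suc i)"
      have x1: "1 < x" "x < 1 + 1 / (t - \<beta> i)" using mem[OF xF] \<beta>(4)[OF i] by auto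
      \<comment> \<open>In these variables the required inequality of densities becomes an equality:
        the measure is invariant under the branch.\<close>
      define s d where "s = x - 1" and "d = t - \<beta> i"
      have s: "s > 0" "d > 0" "s * d < 1"
        using x1 \<beta>(3)[OF i] by (auto simp: s_def d_def field_simps)
      have "1 / (1 - x) = - (1 / s)" by (metis s_def minus_diff_eq divide_minus_right)
      then have y: "\<beta> i - (t + 1 / (1 - x)) = (1 - s * d) / s" "t - (t + 1 / (1 - x)) = 1 / s"
        using s by (auto simp: d_def field_simps)
      have "f (t + 1 / (1 - x)) = s / (1 - s * d) - s"
        using mem[OF xF] y by (simp add: f_def)
      also have "\<dots> = s\<^sup>2 * (d / (1 - s * d))" using s by (simp add: field_simps power2_eq_square)
      finally have "f (t + 1 / (1 - x)) * (1 / (1 - x)\<^sup>2) = d / (1 - s * d)"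
        using s by (simp add: s_def power2_commute[of 1 x])
      moreover have "\<beta> (Suc i) - x = (1 - s * d) / d"
        using s \<beta>(4)[OF i] by (simp add: s_def d_def[symmetric] field_simps)
      ultimately show "1 / (\<beta> (Suc i) - x) \<le> f (t + 1 / (1 - x)) * (1 / (1 - x)\<^sup>2)" by simp
    qed (use f0 in auto)
    then have "a (Suc i) + c i \<le> (\<integral>\<^sup>+x. ennreal (f x) \<partial>lborel) + c i" by (rule add_right_mono)
    also have "\<dots> = (\<integral>\<^sup>+x. ennreal (f x) + ennreal (1 / (t - x)) * indicator (F i) x \<partial>lborel)"
      unfolding c_def by (intro nn_integral_add[symmetric]) (auto simp: f_def)
    also have "\<dots> = a i"
      unfolding a_def
    proof (rule nn_integral_cong)
      fix x
      show "ennreal (f x) + ennreal (1 / (t - x)) * indicator (F i) x = ennreal (1 / (\<beta> i - x)) * indicator (F i) x"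
      proof (cases "x \<in> F i")
        case True
        then have "1 / (t - x) \<ge> 0" using E_bd by (auto simp: F_def less_imp_le)
        then show ?thesis using True f0[of x] by (simp add: ennreal_plus[symmetric] f_def del: ennreal_plus)
      qed (simp add: f_def)
    qed
    finally show ?thesis .
  qed
  \<comment> \<open>Summing \<open>rotate\<close> telescopes, and \<open>a N = c N\<close> because
    \<open>\<beta> N = t\<close>. So the pairs with \<open>p > t\<close> above all of
    \<open>E\<close> have measure at most \<open>a 0\<close>.\<close>
  have "a m + (\<Sum>i<m. c i) \<le> a 0" if "m \<le> N" for m
    using that
  proof (induction m)
    case (Suc m)
    have "a (Suc m) + (\<Sum>i<Suc m. c i) = (a (Suc m) + c m) + (\<Sum>i<m. c i)" by (simp add: ac_simps)
    also have "\<dots> \<le> a m + (\<Sum>i<m. c i)" using rotate[of m] Suc.prems by (intro add_right_mono) simp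
    also have "\<dots> \<le> a 0" using Suc by simp
    finally show ?case .
  qed simp
  moreover have "a N = c N" by (simp add: a_def c_def \<beta>)
  ultimately have "(\<Sum>i<Suc N. c i) \<le> a 0" by (simp add: add.commute) (metis add.commute order_refl)
  moreover have "(\<integral>\<^sup>+x. ennreal (1 / (t - x)) * indicator E x \<partial>lborel) \<le> (\<Sum>i<Suc N. c i)"
  proof -
    have "indicator E x \<le> (\<Sum>i<Suc N. indicator (F i) x :: ennreal)" for x
    proof (cases "x \<in> E")
      case True
      define i where "i = (LEAST i. x < \<beta> i)"
      have "x < \<beta> N" using True E_bd \<beta> by simp
      then have i: "x < \<beta> i" "i \<le> N" unfolding i_def by (rule LeastI, rule Least_le)
      have "\<beta> (i - 1) \<le> x" if "i \<noteq> 0"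
        using not_less_Least[of "i - 1" "\<lambda>i. x < \<beta> i"] that by (simp add: i_def[symmetric])
      then have "x \<in> F i" using True i by (auto simp: F_def)
      then have "indicator E x \<le> (indicator (F i) x :: ennreal)" using True by simp
      also have "\<dots> \<le> (\<Sum>i<Suc N. indicator (F i) x)" using i by (intro member_le_sum) auto
      finally show ?thesis .
    qed simp
    then have "(\<integral>\<^sup>+x. ennreal (1 / (t - x)) * indicator E x \<partial>lborel)
        \<le> (\<integral>\<^sup>+x. (\<Sum>i<Suc N. ennreal (1 / (t - x)) * indicator (F i) x) \<partial>lborel)"
      by (intro nn_integral_mono) (simp only: sum_distrib_left[symmetric] mult_left_mono zero_le)
    also have "\<dots> = (\<Sum>i<Suc N. c i)" unfolding c_def by (intro nn_integral_sum) auto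
    finally show ?thesis .
  qed
  ultimately have le_a0: "(\<integral>\<^sup>+x. ennreal (1 / (t - x)) * indicator E x \<partial>lborel) \<le> a 0" by order

  \<comment> \<open>\<open>F 0\<close> stays below \<open>q < 1\<close>, so the density is bounded.
    Finiteness allows \<open>a 0\<close> to be cancelled at the end.\<close>
  have "a 0 \<le> (\<integral>\<^sup>+x. ennreal (1 / (1 - q)) * indicator {0..1::real} x \<partial>lborel)"
    unfolding a_def
  proof (rule nn_integral_mono)
    fix x
    show "ennreal (1 / (\<beta> 0 - x)) * indicator (F 0) x \<le> ennreal (1 / (1 - q)) * indicator {0..1::real} x"
    proof (cases "x \<in> F 0")
      case True
      then have "x \<in> E" "x < 1" by (auto simp: F_def \<beta>)
      then have x: "x \<le> q" "0 < x" "x < 1" using q E_bd by auto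
      then have "1 / (1 - x) \<le> 1 / (1 - q)" using q(1) by (intro divide_left_mono mult_pos_pos) auto
      then show ?thesis using True x by (simp add: \<beta> ennreal_leI)
    qed simp
  qed
  also have "\<dots> < \<infinity>" by (simp add: nn_integral_cmult)
  finally have a0_fin: "a 0 < \<infinity>" .

  \<comment> \<open>The fibre measures for \<open>p\<close> in
    \<open>((k + 1) t, (k + 1) t + 1)\<close> and, for \<open>gap\<close>, in
    \<open>(t + 1, 2 t)\<close>, which no branch below 1 reaches.\<close>
  define h where "h k y = (1 / (real (Suc k) * t - y) - 1 / (real (Suc k) * t + 1 - y)) * indicator E y" for k y
  define gap where "gap y = (1 / (t + 1 - y) - 1 / (2 * t - y)) * indicator E y" for y
  have kt: "t \<le> real (Suc k) * t" for k using t mult_right_mono[of 1 "real (Suc k)" t] by simp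
  have h0: "h k y \<ge> 0" for k y
  proof (cases "y \<in> E")
    case True
    then have "y < real (Suc k) * t" using E_bd[of y] kt[of k] by linarith
    then have "1 / (real (Suc k) * t + 1 - y) \<le> 1 / (real (Suc k) * t - y)"
      by (intro divide_left_mono mult_pos_pos) linarith+
    then show ?thesis using True by (simp only: h_def indicator_simps) simp
  qed (simp add: h_def)
  have gap0: "gap y \<ge> 0" "y \<in> E \<Longrightarrow> gap y > 0" for y
    using E_bd[of y] t
    by (auto simp: gap_def split: split_indicator intro!: divide_left_mono divide_strict_left_mono mult_pos_pos)
  have [measurable]: "h k \<in> borel_measurable borel" "gap \<in> borel_measurable borel" for k
    unfolding h_def gap_def by measurable
  define G where "G k = {x \<in> F 0. 1 - 1 / x + real (Suc k) * t \<in> E}" for k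
  have G[measurable]: "G k \<in> sets borel" for k unfolding G_def by measurable
  have pos: "0 < 1 / (1 + real (Suc k) * t)" "1 / (1 + real (Suc k) * t) \<le> 1" for k
  proof -
    have "1 + real (Suc k) * t \<ge> 1" using t kt[of k] by linarith
    then show "0 < 1 / (1 + real (Suc k) * t)" "1 / (1 + real (Suc k) * t) \<le> 1" by (simp_all del: of_nat_Suc)
  qed
  have digit: "(\<integral>\<^sup>+x. ennreal (1 / (1 - x)) * indicator (G k) x \<partial>lborel) \<le> (\<integral>\<^sup>+x. ennreal (h k x) \<partial>lborel)" for k
  proof (rule nn_integral_substitution_on[where a = "1 / (1 + real (Suc k) * t)" and b = 1
        and g = "\<lambda>x. 1 - 1 / x + real (Suc k) * t" and g' = "\<lambda>x. 1 / x\<^sup>2"])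
    fix x assume "x \<in> {1 / (1 + real (Suc k) * t)..1}"
    then have "x \<noteq> 0" using pos[of k] by auto
    then show "((\<lambda>x. 1 - 1 / x + real (Suc k) * t) has_real_derivative 1 / x\<^sup>2) (at x)"
      by (auto intro!: derivative_eq_intros simp: power2_eq_square)
  next
    show "continuous_on {1 / (1 + real (Suc k) * t)..1} (\<lambda>x. 1 / x\<^sup>2)"
      using pos[of k] by (intro continuous_intros) force
  next
    show "1 / (1 + real (Suc k) * t) \<le> 1" by (rule pos(2))
    show "G k \<subseteq> {1 / (1 + real (Suc k) * t)..1}"
    proof
      fix x assume x: "x \<in> G k"
      then have "0 < x" "x < 1" "0 < 1 - 1 / x + real (Suc k) * t"
        using E_bd by (auto simp: G_def F_def \<beta>)
      moreover have "0 < 1 + real (Suc k) * t" using kt[of k] t by linarith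
      ultimately show "x \<in> {1 / (1 + real (Suc k) * t)..1}" by (simp add: field_simps del: of_nat_Suc)
    qed
    fix x assume x: "x \<in> G k"
    then have x1: "0 < x" "x < 1" "1 - 1 / x + real (Suc k) * t \<in> E" using E_bd by (auto simp: G_def F_def \<beta>)
    have "real (Suc k) * t - (1 - 1 / x + real (Suc k) * t) = (1 - x) / x"
      "real (Suc k) * t + 1 - (1 - 1 / x + real (Suc k) * t) = 1 / x" using x1 by (auto simp: field_simps)
    then have "h k (1 - 1 / x + real (Suc k) * t) = x / (1 - x) - x" using x1(3) by (simp add: h_def)
    also have "\<dots> = x\<^sup>2 / (1 - x)" using x1 by (simp add: field_simps power2_eq_square)
    finally show "1 / (1 - x) \<le> h k (1 - 1 / x + real (Suc k) * t) * (1 / x\<^sup>2)" using x1 by simp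
  qed (use h0 in auto)
  have "a 0 \<le> (\<integral>\<^sup>+x. (\<Sum>k. ennreal (1 / (1 - x)) * indicator (G k) x) \<partial>lborel)"
    unfolding a_def
  proof (rule nn_integral_mono)
    fix x
    show "ennreal (1 / (\<beta> 0 - x)) * indicator (F 0) x \<le> (\<Sum>k. ennreal (1 / (1 - x)) * indicator (G k) x)"
    proof (cases "x \<in> F 0")
      case True
      then obtain k where "x \<in> G k" using small by (auto simp: F_def G_def \<beta>)
      then have "ennreal (1 / (\<beta> 0 - x)) * indicator (F 0) x = ennreal (1 / (1 - x)) * indicator (G k) x"
        using True \<beta> by simp
      also have "\<dots> \<le> (\<Sum>k. ennreal (1 / (1 - x)) * indicator (G k) x)"
      proof -
        have "g k \<le> suminf g" for g :: "nat \<Rightarrow> ennreal" using sum_le_suminf[of g "{k}"] by simp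
        then show ?thesis .
      qed
      finally show ?thesis .
    qed simp
  qed
  also have "\<dots> = (\<Sum>k. \<integral>\<^sup>+x. ennreal (1 / (1 - x)) * indicator (G k) x \<partial>lborel)"
    by (rule nn_integral_suminf) auto
  also have "\<dots> \<le> (\<Sum>k. \<integral>\<^sup>+x. ennreal (h k x) \<partial>lborel)"
    by (intro suminf_le digit) auto
  also have "\<dots> = (\<integral>\<^sup>+x. (\<Sum>k. ennreal (h k x)) \<partial>lborel)"
    by (rule nn_integral_suminf[symmetric]) auto
  finally have a0_le: "a 0 \<le> (\<integral>\<^sup>+x. (\<Sum>k. ennreal (h k x)) \<partial>lborel)" .
  \<comment> \<open>With \<open>le_a0\<close> this becomes \<open>a 0\<close> plus the integral of
    \<open>gap\<close> at most \<open>a 0\<close>; so the integral vanishes, while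
    \<open>gap\<close> is positive on \<open>E\<close>.\<close>
  have "a 0 + (\<integral>\<^sup>+x. ennreal (gap x) \<partial>lborel)
      \<le> (\<integral>\<^sup>+x. (\<Sum>k. ennreal (h k x)) \<partial>lborel) + (\<integral>\<^sup>+x. ennreal (gap x) \<partial>lborel)"
    by (rule add_right_mono[OF a0_le])
  also have "\<dots> = (\<integral>\<^sup>+x. (\<Sum>k. ennreal (h k x)) + ennreal (gap x) \<partial>lborel)"
    by (intro nn_integral_add[symmetric]) auto
  also have "\<dots> \<le> (\<integral>\<^sup>+x. ennreal (1 / (t - x)) * indicator E x \<partial>lborel)"
  proof (rule nn_integral_mono)
    fix x
    show "(\<Sum>k. ennreal (h k x)) + ennreal (gap x) \<le> ennreal (1 / (t - x)) * indicator E x"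
    proof (cases "x \<in> E")
      case True
      have "(\<Sum>k<m. h k x) + gap x \<le> 1 / (t - x)" for m
        using digit_sum_le[OF t E_bd(2)[OF True], of m] True by (simp add: h_def gap_def)
      then have "(\<Sum>k<m. ennreal (h k x)) + ennreal (gap x) \<le> ennreal (1 / (t - x))" for m
        using h0 gap0(1) by (simp add: sum_nonneg ennreal_plus[symmetric] ennreal_leI del: ennreal_plus)
      then have "(SUP m. (\<Sum>k<m. ennreal (h k x)) + ennreal (gap x)) \<le> ennreal (1 / (t - x))"
        by (rule SUP_least)
      then show ?thesis using True by (simp add: suminf_eq_SUP ennreal_SUP_add_left)
    qed (simp add: h_def gap_def)
  qed
  also have "\<dots> \<le> a 0 + 0" using le_a0 by simp
  finally have "(\<integral>\<^sup>+x. ennreal (gap x) \<partial>lborel) = 0"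
    using a0_fin by (auto simp: ennreal_add_left_cancel_le)
  then have "AE x in lborel. ennreal (gap x) = 0" by (subst (asm) nn_integral_0_iff_AE) auto
  then have "AE x in lborel. x \<notin> E"
    by (rule AE_mp) (auto intro!: AE_I2 simp: ennreal_eq_0_iff dest: gap0(2))
  then show ?thesis by (simp add: AE_iff_null_sets)
qed

text \<open>These are the points of a \<open>rot n\<close>-orbit from \<open>1 - t\<close>, at angle
  pi / n, to 0, at angle pi - pi / n, all translated by \<open>t\<close>. The branch of
  \<open>first_map\<close> above 1 is the inverse of \<open>rot n\<close> conjugated by this
  translation.\<close>

lemma rot_angle_boundaries:
  assumes "n \<ge> 3"
  defines "\<beta> \<equiv> \<lambda>i. tval n + rot_angle n (real (Suc i) * (pi / n))"
  shows "\<beta> 0 = 1" "\<beta> (n - 2) = tval n" "i < n - 2 \<Longrightarrow> \<beta> i < tval n"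
    "i < n - 2 \<Longrightarrow> \<beta> (Suc i) = 1 + 1 / (tval n - \<beta> i)"
proof -
  define p where "p = pi / n"
  have p: "0 < p" "p < pi" "real n * p = pi" using assms by (auto simp: p_def field_simps)
  have angle: "0 < real (Suc i) * p \<and> real (Suc i) * p + p < pi" if "i < n - 2" for i
  proof -
    have "real (Suc (Suc i)) < real n" using that by linarith
    then have "real (Suc (Suc i)) * p < real n * p" using p by (intro mult_strict_right_mono)
    then show ?thesis using p by (simp add: algebra_simps add_pos_nonneg)
  qed
  have "sin p > 0" using p by (intro sin_gt_zero)
  then show "\<beta> 0 = 1"
    by (simp add: \<beta>_def rot_angle_def p_def[symmetric] tval_def sin_add)
  have "real (Suc (n - 2)) * p + p = pi"
    using p(3) assms(1) by (simp add: of_nat_diff algebra_simps)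
  then show "\<beta> (n - 2) = tval n"
    unfolding \<beta>_def rot_angle_def p_def[symmetric] by simp
  show "\<beta> i < tval n" if "i < n - 2"
    using angle[OF that] rot_angle_sign(1)[of n "real (Suc i) * p"] assms(1) p(1)
    unfolding \<beta>_def p_def[symmetric] by linarith
  show "\<beta> (Suc i) = 1 + 1 / (tval n - \<beta> i)" if "i < n - 2"
  proof -
    define \<theta> where "\<theta> = real (Suc i) * p"
    have "sin \<theta> > 0" "sin (\<theta> + p) > 0"
      using angle[OF that] p unfolding \<theta>_def by (intro sin_gt_zero; linarith)+
    then have "rot n (rot_angle n \<theta>) = rot_angle n (\<theta> + p)"
      using rot_rot_angle[of \<theta> n] by (simp add: p_def)
    moreover have "\<theta> + p = real (Suc (Suc i)) * p" by (simp add: \<theta>_def algebra_simps)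
    ultimately have "\<beta> (Suc i) = tval n + rot n (\<beta> i - tval n)"
      by (simp add: \<beta>_def p_def[symmetric] \<theta>_def)
    moreover have "1 / (\<beta> i - tval n) = - (1 / (tval n - \<beta> i))"
      by (metis minus_diff_eq divide_minus_right)
    ultimately show ?thesis by (simp add: rot_def)
  qed
qed

section \<open>Orbits of \<open>first_map\<close> bounded away from \<open>t\<close>\<close>

lemma first_map_measurable [measurable]: "first_map t \<in> borel_measurable borel"
  unfolding first_map_def by measurable

lemma first_map_lt_1:
  assumes "t > 0" "0 < x" "x < 1"
  shows "\<exists>k. first_map t x = 1 - 1 / x + real (Suc k) * t"
proof -
  have "(1 - 1 / x) / t < 0" using assms by (simp add: field_simps)
  then have "\<lfloor>(1 - 1 / x) / t\<rfloor> < 0" by simp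
  then obtain k where "\<lfloor>(1 - 1 / x) / t\<rfloor> = - int (Suc k)"
    using negD by blast
  note fl = this
  show ?thesis
    using assms unfolding first_map_def fl by (intro exI[of _ k]) (simp add: algebra_simps)
qed

lemma bounded_first_map_orbits_null:
  assumes n: "n \<ge> 3" and \<rho>: "\<rho> < tval n"
  shows "{x. \<forall>m. (first_map (tval n) ^^ m) x \<in> {0<..\<rho>} - {1}} \<in> null_sets lborel" (is "?E \<in> _")
proof -
  let ?t = "tval n"
  have t: "?t \<ge> 2" "?t > 0" using tval_bounds[OF n] by auto
  have ran: "0 < x" "x \<le> \<rho>" "x \<noteq> 1" and closed: "first_map ?t x \<in> ?E" if "x \<in> ?E" for x
  proof -
    have "(first_map ?t ^^ 0) x \<in> {0<..\<rho>} - {1}" using that by blast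
    then show "0 < x" "x \<le> \<rho>" "x \<noteq> 1" by auto
    have "(first_map ?t ^^ m) (first_map ?t x) \<in> {0<..\<rho>} - {1}" for m
    proof -
      have "(first_map ?t ^^ Suc m) x \<in> {0<..\<rho>} - {1}" using that by blast
      then show ?thesis by (simp only: funpow_Suc_right comp_apply)
    qed
    then show "first_map ?t x \<in> ?E" by blast
  qed
  \<comment> \<open>The image of \<open>x\<close> is at least \<open>1 - 1 / x + t\<close> and at
    most \<open>\<rho> < t\<close>, which keeps \<open>1 / x\<close> away from 1.\<close>
  have q: "x \<le> 1 / (1 + ?t - \<rho>)" if x: "x \<in> ?E" "x < 1" for x
  proof -
    obtain k where k: "first_map ?t x = 1 - 1 / x + real (Suc k) * ?t"
      using first_map_lt_1[OF t(2) ran(1)[OF x(1)] x(2)] by blast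
    have "1 * ?t \<le> real (Suc k) * ?t" using t by (intro mult_right_mono) auto
    then have "1 + ?t - \<rho> \<le> 1 / x" using k ran(2)[OF closed[OF x(1)]] by linarith
    then show ?thesis using ran(1)[OF x(1)] \<rho> by (simp add: field_simps)
  qed
  have [measurable]: "(first_map ?t ^^ m) \<in> borel_measurable borel" for m
    by (rule measurable_compose_n) measurable
  show ?thesis
  proof (rule invariant_set_null[where t = ?t and q = "1 / (1 + ?t - \<rho>)" and N = "n - 2"
        and \<beta> = "\<lambda>i. ?t + rot_angle n (real (Suc i) * (pi / n))"])
    show "?E \<in> sets borel" by measurable
    show "?E \<subseteq> {0<..<?t}"
    proof
      fix x assume "x \<in> ?E"
      from ran(1,2)[OF this] \<rho> show "x \<in> {0<..<?t}" by simp
    qed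
    show "1 \<notin> ?E" using ran(3) by blast
    show "1 / (1 + ?t - \<rho>) < 1" using \<rho> by simp
    show "\<exists>k. 1 - 1 / x + real (Suc k) * ?t \<in> ?E" if x: "x \<in> ?E" "x < 1" for x
    proof -
      obtain k where "first_map ?t x = 1 - 1 / x + real (Suc k) * ?t"
        using first_map_lt_1[OF t(2) ran(1)[OF x(1)] x(2)] by blast
      with closed[OF x(1)] show ?thesis by (intro exI[of _ k]) (simp only:)
    qed
    show "?t + 1 / (1 - x) \<in> ?E" if "x \<in> ?E" "1 < x" for x
    proof -
      have "first_map ?t x = ?t + 1 / (1 - x)" using that(2) by (simp add: first_map_def)
      with closed[OF that(1)] show ?thesis by (simp only:)
    qed
    show "?t \<ge> 2" by (rule t(1))
    show "x \<le> 1 / (1 + ?t - \<rho>)" if "x \<in> ?E" "x < 1" for x by (rule q[OF that])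
    show "?t + rot_angle n (real (Suc 0) * (pi / n)) = 1" by (rule rot_angle_boundaries(1)[OF n])
    show "?t + rot_angle n (real (Suc (n - 2)) * (pi / n)) = ?t" by (rule rot_angle_boundaries(2)[OF n])
    fix i assume i: "i < n - 2"
    show "?t + rot_angle n (real (Suc i) * (pi / n)) < ?t" by (rule rot_angle_boundaries(3)[OF n i])
    show "?t + rot_angle n (real (Suc (Suc i)) * (pi / n))
        = 1 + 1 / (?t - (?t + rot_angle n (real (Suc i) * (pi / n))))"
      by (rule rot_angle_boundaries(4)[OF n i])
  qed
qed

section \<open>From values of \<open>r0\<close> to parameters\<close>

theorem theorem1:
  fixes n :: nat
  assumes "n \<ge> 3"
  shows "{0<..<1} - {\<alpha>\<in>{0<..<1::real}. \<exists>i j.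
            (T_map n \<alpha> ^^ i) (Some (r0 n \<alpha>)) = (T_map n \<alpha> ^^ j) (Some (ell0 n \<alpha>))}
         \<in> null_sets lebesgue"
proof -
  let ?t = "tval n"
  have t: "?t > 0" using tval_bounds[OF assms] by simp
  define E where "E \<rho> = {x. \<forall>m. (first_map ?t ^^ m) x \<in> {0<..\<rho>} - {1}}" for \<rho>
  \<comment> \<open>\<open>E \<rho>\<close> does not depend on \<alpha>, and a rational \<rho> fits
    between \<open>r0\<close> and \<open>t\<close>; so countably many null sets suffice.\<close>
  define Z where "Z = cusps ?t \<union> (\<Union>\<rho>\<in>\<rat> \<inter> {..<?t}. E \<rho>)"
  have "E \<rho> \<in> null_sets lborel" if "\<rho> < ?t" for \<rho>
    using bounded_first_map_orbits_null[OF assms that] by (simp add: E_def)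
  then have "Z \<in> null_sets lborel"
    unfolding Z_def
    by (rule null_sets.Un[OF countable_imp_null_set_lborel[OF countable_cusps]
          null_sets_UN'[OF countable_Int1[OF countable_rat]]]) auto
  then have "negligible Z"
    by (simp add: negligible_iff_null_sets null_sets_completionI)
  then have "negligible ((\<lambda>x. (1 / ?t) *\<^sub>R x) ` Z)"
    by (intro negligible_differentiable_image_negligible linear_imp_differentiable_on linear_scale_self) simp_all
  moreover have "{0<..<1} - {\<alpha>\<in>{0<..<1::real}. \<exists>i j.
            (T_map n \<alpha> ^^ i) (Some (r0 n \<alpha>)) = (T_map n \<alpha> ^^ j) (Some (ell0 n \<alpha>))}
      \<subseteq> (\<lambda>x. (1 / ?t) *\<^sub>R x) ` Z"
  proof
    fix \<alpha> assume \<alpha>: "\<alpha> \<in> {0<..<1} - {\<alpha>\<in>{0<..<1::real}. \<exists>i j.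
            (T_map n \<alpha> ^^ i) (Some (r0 n \<alpha>)) = (T_map n \<alpha> ^^ j) (Some (ell0 n \<alpha>))}"
    have "r0 n \<alpha> \<in> Z"
    proof (cases "r0 n \<alpha> \<in> cusps ?t")
      case False
      interpret no_synchronization n \<alpha>
        by unfold_locales (use assms \<alpha> False in auto)
      obtain \<rho> where \<rho>: "\<rho> \<in> \<rat>" "r < \<rho>" "\<rho> < ?t" using Rats_dense_in_real[OF lr(3)] by blast
      then have "{0<..r} - {1} \<subseteq> {0<..\<rho>} - {1}" by auto
      then have "r \<in> E \<rho>" unfolding E_def using first_map_orbit by blast
      then show ?thesis using \<rho> by (auto simp: Z_def)
    qed (simp add: Z_def)
    moreover have "\<alpha> = (1 / ?t) *\<^sub>R r0 n \<alpha>" using t by (simp add: r0_def)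
    ultimately show "\<alpha> \<in> (\<lambda>x. (1 / ?t) *\<^sub>R x) ` Z" by blast
  qed
  ultimately show ?thesis
    using negligible_subset negligible_iff_null_sets by blast
qed

end
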